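(* For any $\Gamma\in\mathbb{N}$ and $\alpha\in\mathbb{R}$ there are instances (graphs $G=(V,A,s,t,u)$) such that $f^*_{pm}>\alpha f^*_{am}$ and consequently $f^*_{gm}>\alpha f^*_{am}$, where $f^*_{pm}$, $f^*_{am}$, $f^*_{gm}$ are the optimal values of the path model (PM), the arc model (AM) and the general model (GM), respectively.
   Context: $\mathbb{N}=\{1,2,\dots\}$. $G=(V,A,s,t,u)$ is a finite directed graph (parallel arcs allowed) with two distinct nodes, source $s$ and sink $t$, and capacities $u_a\in\mathbb{N}$ for $a\in A$. The source $s$ has no incoming arcs, $t$ has no outgoing arcs, and for every $v\in V\setminus\{s,t\}$ there is a directed $s$-$v$-$t$-path. $\delta_A^-(v)$, $\delta_A^+(v)$ are the sets of incoming and outgoing arcs of $v$. For $\Gamma\in\mathbb{N}$ let $\mathcal{S}=\{S\subseteq A: |S|\le\Gamma\}$ and $\Lambda=\{z\in\{0,1\}^{|A|}:\sum_{a\in A}z(a)\le\Gamma\}$. $\mathcal{P}$ is the set of all simple $s$-$t$-paths, and $\bar{\mathcal{P}}$ is the set of all directed $v$-$w$-paths $P$ ($v,w\in V$, at least one arc) that are subpaths of some path in $\mathcal{P}$; paths are identified with their arc sets. $\delta_{\bar{\mathcal{P}}}^-(v)$ and $\delta_{\bar{\mathcal{P}}}^+(v)$ are the sets of paths in $\bar{\mathcal{P}}$ ending at $v$ and starting at $v$. Path model (PM): $f^*_{pm}=\max_{x\in\mathbb{R}_{\ge0}^{|\mathcal{P}|}}\sum_{P\in\mathcal{P}}x(P)-\max_{S\in\mathcal{S}}\sum_{P\in\mathcal{P}:P\cap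 S\ne\emptyset}x(P)$ subject to $\sum_{P\in\mathcal{P}:a\in P}x(P)\le u_a$ for all $a\in A$. Arc model (AM): $f^*_{am}=\max_{x\in\mathbb{R}_{\ge0}^{|A|}}\sum_{a\in\delta_A^-(t)}x(a)-\max_{z\in\Lambda}\sum_{a\in\delta_A^-(t)}z(a)x(a)$ subject to $\sum_{a\in\delta_A^-(v)}(1-z(a))x(a)-\sum_{a\in\delta_A^+(v)}x(a)\ge0$ for all $v\in V\setminus\{s,t\}$, $z\in\Lambda$, and $x(a)\le u_a$ for all $a\in A$. General model (GM): $f^*_{gm}=\max_{x\in\mathbb{R}^{|\bar{\mathcal{P}}|}_{\ge0}}\sum_{P\in\delta_{\bar{\mathcal{P}}}^-(t)}x(P)-\max_{S\in\mathcal{S}}\sum_{P\in\delta_{\bar{\mathcal{P}}}^-(t):P\cap S\ne\emptyset}x(P)$ subject to $\sum_{P\in\delta_{\bar{\mathcal{P}}}^-(v)}x(P)-\sum_{P\in\delta_{\bar{\mathcal{P}}}^-(v):P\cap S\neq\emptyset}x(P)\ge\sum_{P\in\delta_{\bar{\mathcal{P}}}^+(v)}x(P)$ for all $v\in V\setminus\{s,t\}$, $S\in\mathcal{S}$, and $\sum_{P\in\bar{\mathcal{P}}:a\in P}x(P)\le u_a$ for all $a\in A$. *)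

theory Defs
  imports
    Complex_Main
    "HOL-Library.FuncSet"
    "HOL-Library.Sublist"
    "Graph_Theory.Arc_Walk"
begin

text \<open>
  The path through \<open>v\<close> in the last assumption is required to be simple. Since networks are only
  claimed to exist, this is the stronger of the possible readings.
\<close>

locale flow_network = fin_digraph G for G :: "('v, 'a) pre_digraph" +
  fixes s t :: 'v and u :: "'a \<Rightarrow> nat"
  assumes source_in_verts: "s \<in> verts G"
    and sink_in_verts: "t \<in> verts G"
    and source_neq_sink: "s \<noteq> t"
    and in_arcs_source: "in_arcs G s = {}"
    and out_arcs_sink: "out_arcs G t = {}"
    and capacity_pos: "a \<in> arcs G \<Longrightarrow> 1 \<le> u a"
    and path_through: "v \<in> verts G - {s, t} \<Longrightarrow>
      \<exists>p. pre_digraph.apath G s p t \<and> v \<in> set (pre_digraph.awalk_verts G s p)"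

definition scenarios :: "('v, 'a) pre_digraph \<Rightarrow> nat \<Rightarrow> 'a set set" where
  "scenarios G \<Gamma> = {S. S \<subseteq> arcs G \<and> card S \<le> \<Gamma>}"

definition scenario_vectors :: "('v, 'a) pre_digraph \<Rightarrow> nat \<Rightarrow> ('a \<Rightarrow> real) set" where
  "scenario_vectors G \<Gamma> = {z \<in> arcs G \<rightarrow>\<^sub>E {0, 1}. (\<Sum>a\<in>arcs G. z a) \<le> real \<Gamma>}"

text \<open>Paths are identified with their arc sets.\<close>

definition st_paths :: "('v, 'a) pre_digraph \<Rightarrow> 'v \<Rightarrow> 'v \<Rightarrow> 'a set set" where
  "st_paths G s t = {set p | p. pre_digraph.apath G s p t}"

definition subpaths_between ::
    "('v, 'a) pre_digraph \<Rightarrow> 'v \<Rightarrow> 'v \<Rightarrow> 'v \<Rightarrow> 'v \<Rightarrow> 'a set set" where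
  "subpaths_between G s t v w = {set q | q. q \<noteq> [] \<and> pre_digraph.apath G v q w \<and>
     (\<exists>p. pre_digraph.apath G s p t \<and> sublist q p)}"

definition subpaths :: "('v, 'a) pre_digraph \<Rightarrow> 'v \<Rightarrow> 'v \<Rightarrow> 'a set set" where
  "subpaths G s t = (\<Union>v\<in>verts G. \<Union>w\<in>verts G. subpaths_between G s t v w)"

definition in_subpaths :: "('v, 'a) pre_digraph \<Rightarrow> 'v \<Rightarrow> 'v \<Rightarrow> 'v \<Rightarrow> 'a set set" where
  "in_subpaths G s t v = (\<Union>w\<in>verts G. subpaths_between G s t w v)"

definition out_subpaths :: "('v, 'a) pre_digraph \<Rightarrow> 'v \<Rightarrow> 'v \<Rightarrow> 'v \<Rightarrow> 'a set set" where
  "out_subpaths G s t v = (\<Union>w\<in>verts G. subpaths_between G s t v w)"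

text \<open>
  \<open>optimal_value f P c\<close> says that the maximum of \<open>f\<close> over all \<open>x\<close> with \<open>P x\<close> is attained and equals
  \<open>c\<close>. Vectors indexed by arcs or paths are total functions of which only the values on the index
  set are used.
\<close>

definition optimal_value :: "('x \<Rightarrow> real) \<Rightarrow> ('x \<Rightarrow> bool) \<Rightarrow> real \<Rightarrow> bool" where
  "optimal_value f P c \<longleftrightarrow> (\<exists>x. is_arg_max f P x \<and> f x = c)"

definition pm_objective ::
    "('v, 'a) pre_digraph \<Rightarrow> 'v \<Rightarrow> 'v \<Rightarrow> nat \<Rightarrow> ('a set \<Rightarrow> real) \<Rightarrow> real" where
  "pm_objective G s t \<Gamma> x =
     (\<Sum>P\<in>st_paths G s t. x P) -
     (MAX S\<in>scenarios G \<Gamma>. \<Sum>P\<in>{P \<in> st_paths G s t. P \<inter> S \<noteq> {}}. x P)"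

definition pm_feasible ::
    "('v, 'a) pre_digraph \<Rightarrow> 'v \<Rightarrow> 'v \<Rightarrow> ('a \<Rightarrow> nat) \<Rightarrow> ('a set \<Rightarrow> real) \<Rightarrow> bool" where
  "pm_feasible G s t u x \<longleftrightarrow>
     (\<forall>P\<in>st_paths G s t. 0 \<le> x P) \<and>
     (\<forall>a\<in>arcs G. (\<Sum>P\<in>{P \<in> st_paths G s t. a \<in> P}. x P) \<le> real (u a))"

definition pm_value ::
    "('v, 'a) pre_digraph \<Rightarrow> 'v \<Rightarrow> 'v \<Rightarrow> ('a \<Rightarrow> nat) \<Rightarrow> nat \<Rightarrow> real \<Rightarrow> bool" where
  "pm_value G s t u \<Gamma> = optimal_value (pm_objective G s t \<Gamma>) (pm_feasible G s t u)"

definition am_objective ::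
    "('v, 'a) pre_digraph \<Rightarrow> 'v \<Rightarrow> nat \<Rightarrow> ('a \<Rightarrow> real) \<Rightarrow> real" where
  "am_objective G t \<Gamma> x =
     (\<Sum>a\<in>in_arcs G t. x a) -
     (MAX z\<in>scenario_vectors G \<Gamma>. \<Sum>a\<in>in_arcs G t. z a * x a)"

definition am_feasible ::
    "('v, 'a) pre_digraph \<Rightarrow> 'v \<Rightarrow> 'v \<Rightarrow> ('a \<Rightarrow> nat) \<Rightarrow> nat \<Rightarrow> ('a \<Rightarrow> real) \<Rightarrow> bool" where
  "am_feasible G s t u \<Gamma> x \<longleftrightarrow>
     (\<forall>a\<in>arcs G. 0 \<le> x a) \<and>
     (\<forall>v\<in>verts G - {s, t}. \<forall>z\<in>scenario_vectors G \<Gamma>.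
        (\<Sum>a\<in>in_arcs G v. (1 - z a) * x a) - (\<Sum>a\<in>out_arcs G v. x a) \<ge> 0) \<and>
     (\<forall>a\<in>arcs G. x a \<le> real (u a))"

definition am_value ::
    "('v, 'a) pre_digraph \<Rightarrow> 'v \<Rightarrow> 'v \<Rightarrow> ('a \<Rightarrow> nat) \<Rightarrow> nat \<Rightarrow> real \<Rightarrow> bool" where
  "am_value G s t u \<Gamma> = optimal_value (am_objective G t \<Gamma>) (am_feasible G s t u \<Gamma>)"

definition gm_objective ::
    "('v, 'a) pre_digraph \<Rightarrow> 'v \<Rightarrow> 'v \<Rightarrow> nat \<Rightarrow> ('a set \<Rightarrow> real) \<Rightarrow> real" where
  "gm_objective G s t \<Gamma> x =
     (\<Sum>P\<in>in_subpaths G s t t. x P) -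
     (MAX S\<in>scenarios G \<Gamma>. \<Sum>P\<in>{P \<in> in_subpaths G s t t. P \<inter> S \<noteq> {}}. x P)"

definition gm_feasible ::
    "('v, 'a) pre_digraph \<Rightarrow> 'v \<Rightarrow> 'v \<Rightarrow> ('a \<Rightarrow> nat) \<Rightarrow> nat \<Rightarrow> ('a set \<Rightarrow> real) \<Rightarrow> bool" where
  "gm_feasible G s t u \<Gamma> x \<longleftrightarrow>
     (\<forall>P\<in>subpaths G s t. 0 \<le> x P) \<and>
     (\<forall>v\<in>verts G - {s, t}. \<forall>S\<in>scenarios G \<Gamma>.
        (\<Sum>P\<in>in_subpaths G s t v. x P) -
        (\<Sum>P\<in>{P \<in> in_subpaths G s t v. P \<inter> S \<noteq> {}}. x P)
          \<ge> (\<Sum>P\<in>out_subpaths G s t v. x P)) \<and>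
     (\<forall>a\<in>arcs G. (\<Sum>P\<in>{P \<in> subpaths G s t. a \<in> P}. x P) \<le> real (u a))"

definition gm_value ::
    "('v, 'a) pre_digraph \<Rightarrow> 'v \<Rightarrow> 'v \<Rightarrow> ('a \<Rightarrow> nat) \<Rightarrow> nat \<Rightarrow> real \<Rightarrow> bool" where
  "gm_value G s t u \<Gamma> = optimal_value (gm_objective G s t \<Gamma>) (gm_feasible G s t u \<Gamma>)"

end

theory Submission
  imports Defs
begin

text \<open>
  Take \<open>\<Gamma> + 1\<close> parallel paths of two arcs from \<open>s\<close> to \<open>t\<close> with unit capacities. Every inner node
  has a single incoming arc, so in the arc model one failure already forces its outflow, and hence
  the optimal value, to be 0. In the path model a unit of flow on every path survives with value 1,
  because \<open>\<Gamma>\<close> arcs meet at most \<open>\<Gamma>\<close> of the disjoint paths. The same flow is optimal in the general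
  model, where the last arc of a path, taken as a separate subpath, carries no flow for the same
  reason as in the arc model.
\<close>

text \<open>
  The inner nodes are \<open>i < n\<close>, the source is \<open>n\<close> and the sink \<open>n + 1\<close>; arc \<open>i\<close> enters node \<open>i\<close> from
  the source, arc \<open>n + i\<close> leaves it to the sink.
\<close>

definition parallel_paths :: "nat \<Rightarrow> (nat, nat) pre_digraph" where
  "parallel_paths n = \<lparr>verts = {..<n + 2}, arcs = {..<2 * n},
     tail = (\<lambda>a. if a < n then n else a - n), head = (\<lambda>a. if a < n then a else Suc n)\<rparr>"

lemma verts_parallel_paths [simp]: "verts (parallel_paths n) = {..<n + 2}"
  and arcs_parallel_paths [simp]: "arcs (parallel_paths n) = {..<2 * n}"
  and tail_parallel_paths [simp]: "tail (parallel_paths n) a = (if a < n then n else a - n)"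
  and head_parallel_paths [simp]: "head (parallel_paths n) a = (if a < n then a else Suc n)"
  by (simp_all add: parallel_paths_def)

section \<open>Arcs and source-sink paths of the network\<close>

lemma in_arcs_sink_parallel_paths: "in_arcs (parallel_paths n) (Suc n) = {n..<2 * n}"
  by (auto simp: in_arcs_def)

lemma in_arcs_inner_parallel_paths: "i < n \<Longrightarrow> in_arcs (parallel_paths n) i = {i}"
  by (auto simp: in_arcs_def split: if_splits)

lemma out_arcs_inner_parallel_paths: "i < n \<Longrightarrow> out_arcs (parallel_paths n) i = {n + i}"
  by (auto simp: out_arcs_def split: if_splits)

lemmas walk_simps = pre_digraph.apath_def pre_digraph.awalk_def
  pre_digraph.cas.simps pre_digraph.awalk_verts.simps

text \<open>The walk is forced: an arc out of the source enters some node \<open>i\<close>, the only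
  arc out of \<open>i\<close> is \<open>n + i\<close>, and no arc leaves the sink, so nothing can
  follow.\<close>

lemma apath_source_sink_parallel_paths:
  "pre_digraph.apath (parallel_paths n) n p (Suc n) \<longleftrightarrow> (\<exists>i<n. p = [i, n + i])"
proof
  assume path: "pre_digraph.apath (parallel_paths n) n p (Suc n)"
  then obtain a q where p: "p = a # q"
    by (cases p) (auto simp: walk_simps)
  with path have a: "a < n" and q: "set q \<subseteq> {..<2 * n}"
    and cas: "pre_digraph.cas (parallel_paths n) a q (Suc n)"
    by (auto simp: walk_simps split: if_splits)
  from cas a obtain b r where q': "q = b # r"
    by (cases q) (auto simp: walk_simps)
  from cas a q have b: "b = n + a" and r: "pre_digraph.cas (parallel_paths n) (Suc n) r (Suc n)"
    by (auto simp: q' walk_simps split: if_splits)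
  from r q have "r = []"
    by (cases r) (auto simp: q' walk_simps split: if_splits)
  with a b q' p show "\<exists>i<n. p = [i, n + i]"
    by auto
qed (auto simp: walk_simps)

lemma flow_network_parallel_paths: "flow_network (parallel_paths n) n (Suc n) (\<lambda>_. 1)"
proof (intro flow_network.intro flow_network_axioms.intro)
  show "fin_digraph (parallel_paths n)"
    by unfold_locales auto
next
  fix v assume v: "v \<in> verts (parallel_paths n) - {n, Suc n}"
  then have "pre_digraph.apath (parallel_paths n) n [v, n + v] (Suc n)"
    unfolding apath_source_sink_parallel_paths by auto
  with v show "\<exists>p. pre_digraph.apath (parallel_paths n) n p (Suc n) \<and>
      v \<in> set (pre_digraph.awalk_verts (parallel_paths n) n p)"
    by (intro exI conjI) (assumption, auto simp: walk_simps)
qed (auto simp: in_arcs_def out_arcs_def split: if_splits)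

lemma st_paths_parallel_paths:
  "st_paths (parallel_paths n) n (Suc n) = (\<lambda>i. {i, n + i}) ` {..<n}"
proof -
  have "st_paths (parallel_paths n) n (Suc n) = {set [i, n + i] | i. i < n}"
    unfolding st_paths_def apath_source_sink_parallel_paths by blast
  then show ?thesis by auto
qed

text \<open>The paths are arc-disjoint, and \<open>a mod n\<close> recovers the index of the path
  from either of its arcs \<open>i\<close> and \<open>n + i\<close>. Capacity sums over paths thus
  have a single term.\<close>

lemma st_paths_through_parallel_paths:
  assumes "a < 2 * n"
  shows "{P \<in> st_paths (parallel_paths n) n (Suc n). a \<in> P} = {{a mod n, n + a mod n}}"
proof -
  have "a mod n = (if a < n then a else a - n)"
    using assms by (auto simp: le_mod_geq)
  then have "{i \<in> {..<n}. a \<in> {i, n + i}} = {a mod n}"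
    using assms by auto
  then show ?thesis
    by (simp only: st_paths_parallel_paths Compr_image_eq image_insert image_empty)
qed

section \<open>Subpaths of source-sink paths\<close>

lemma sublist_pair_iff: "sublist q [a, b] \<longleftrightarrow> q \<in> {[], [a], [b], [a, b]}"
  by (auto simp: sublist_Cons_right prefix_Cons)

lemma subpaths_between_parallel_paths:
  "P \<in> subpaths_between (parallel_paths n) n (Suc n) v w \<longleftrightarrow>
     (\<exists>i<n. v = n \<and> w = i \<and> P = {i} \<or> v = i \<and> w = Suc n \<and> P = {n + i} \<or>
            v = n \<and> w = Suc n \<and> P = {i, n + i})"
proof -
  have "P \<in> subpaths_between (parallel_paths n) n (Suc n) v w \<longleftrightarrow>
      (\<exists>i<n. \<exists>q\<in>{[i], [n + i], [i, n + i]}.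
         pre_digraph.apath (parallel_paths n) v q w \<and> P = set q)"
    unfolding subpaths_between_def apath_source_sink_parallel_paths mem_Collect_eq
    using sublist_pair_iff by (smt (verit) insert_iff empty_iff list.distinct(1))
  also have "\<dots> \<longleftrightarrow>
     (\<exists>i<n. v = n \<and> w = i \<and> P = {i} \<or> v = i \<and> w = Suc n \<and> P = {n + i} \<or>
            v = n \<and> w = Suc n \<and> P = {i, n + i})"
    by (intro arg_cong[where f = Ex] ext conj_cong refl) (auto simp: walk_simps)
  finally show ?thesis .
qed

lemma subpaths_between_parallel_pathsI:
  assumes "i < n"
  shows "{i} \<in> subpaths_between (parallel_paths n) n (Suc n) n i"
    and "{n + i} \<in> subpaths_between (parallel_paths n) n (Suc n) i (Suc n)"
    and "{i, n + i} \<in> subpaths_between (parallel_paths n) n (Suc n) n (Suc n)"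
  using assms unfolding subpaths_between_parallel_paths by blast+

text \<open>Separates the full paths from the single last arcs; only the latter distinguish the
  objective of the general model from that of the path model.\<close>

lemma in_subpaths_sink_parallel_paths:
  "in_subpaths (parallel_paths n) n (Suc n) (Suc n) =
     st_paths (parallel_paths n) n (Suc n) \<union> (\<lambda>i. {n + i}) ` {..<n}"
  unfolding in_subpaths_def st_paths_parallel_paths
proof (intro equalityI Un_least image_subsetI)
  fix i assume "i \<in> {..<n}"
  then have i: "i < n" by simp
  have "{i, n + i} \<in> (\<Union>w\<in>verts (parallel_paths n).
      subpaths_between (parallel_paths n) n (Suc n) w (Suc n))"
    by (rule UN_I[of n], simp) (rule subpaths_between_parallel_pathsI(3)[OF i])
  moreover have "{n + i} \<in> (\<Union>w\<in>verts (parallel_paths n).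
      subpaths_between (parallel_paths n) n (Suc n) w (Suc n))"
    by (rule UN_I[of i], use i in simp) (rule subpaths_between_parallel_pathsI(2)[OF i])
  ultimately show "{i, n + i} \<in> (\<Union>w\<in>verts (parallel_paths n).
        subpaths_between (parallel_paths n) n (Suc n) w (Suc n))"
    and "{n + i} \<in> (\<Union>w\<in>verts (parallel_paths n).
        subpaths_between (parallel_paths n) n (Suc n) w (Suc n))" .
qed (auto simp: subpaths_between_parallel_paths)

lemma in_subpaths_inner_parallel_paths:
  assumes "i < n"
  shows "in_subpaths (parallel_paths n) n (Suc n) i = {{i}}"
  unfolding in_subpaths_def
proof (rule equalityI)
  show "{{i}} \<subseteq> (\<Union>w\<in>verts (parallel_paths n).
      subpaths_between (parallel_paths n) n (Suc n) w i)"
    unfolding insert_subset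
    by (intro conjI empty_subsetI, rule UN_I[of n], simp)
      (rule subpaths_between_parallel_pathsI(1)[OF assms])
qed (use assms in \<open>auto simp: subpaths_between_parallel_paths\<close>)

lemma out_subpaths_inner_parallel_paths:
  assumes "i < n"
  shows "out_subpaths (parallel_paths n) n (Suc n) i = {{n + i}}"
  unfolding out_subpaths_def
proof (rule equalityI)
  show "{{n + i}} \<subseteq> (\<Union>w\<in>verts (parallel_paths n).
      subpaths_between (parallel_paths n) n (Suc n) i w)"
    unfolding insert_subset
    by (intro conjI empty_subsetI, rule UN_I[of "Suc n"], simp)
      (rule subpaths_between_parallel_pathsI(2)[OF assms])
qed (use assms in \<open>auto simp: subpaths_between_parallel_paths\<close>)

lemma subpaths_parallel_paths:
  "subpaths (parallel_paths n) n (Suc n) =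
     st_paths (parallel_paths n) n (Suc n) \<union> (\<lambda>a. {a}) ` {..<2 * n}"
proof (intro equalityI subsetI)
  fix P assume "P \<in> subpaths (parallel_paths n) n (Suc n)"
  then show "P \<in> st_paths (parallel_paths n) n (Suc n) \<union> (\<lambda>a. {a}) ` {..<2 * n}"
    by (auto simp: subpaths_def subpaths_between_parallel_paths st_paths_parallel_paths)
next
  fix P assume "P \<in> st_paths (parallel_paths n) n (Suc n) \<union> (\<lambda>a. {a}) ` {..<2 * n}"
  \<comment> \<open>A single arc \<open>a\<close> gives \<open>i = a\<close> if \<open>a < n\<close>
    and \<open>i = a - n\<close> otherwise.\<close>
  then obtain i where i: "i < n" and P: "P = {i, n + i} \<or> P = {i} \<or> P = {n + i}"
    by (auto simp: st_paths_parallel_paths) (metis add_diff_inverse_nat mult_2 nat_add_left_cancel_less)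
  from i have "n \<in> verts (parallel_paths n)" "Suc n \<in> verts (parallel_paths n)"
    "i \<in> verts (parallel_paths n)"
    by simp_all
  with P subpaths_between_parallel_pathsI[OF i] show "P \<in> subpaths (parallel_paths n) n (Suc n)"
    unfolding subpaths_def by blast
qed

section \<open>Optimal value of the path model\<close>

lemma finite_scenarios: "finite (arcs G) \<Longrightarrow> finite (scenarios G \<Gamma>)"
  by (simp add: scenarios_def)

lemma empty_in_scenarios: "{} \<in> scenarios G \<Gamma>"
  by (simp add: scenarios_def)

lemma optimal_valueI:
  assumes "P x" and "f x = c" and "\<And>y. P y \<Longrightarrow> f y \<le> c"
  shows "optimal_value f P c"
  using assms unfolding optimal_value_def is_arg_max_linorder by auto

text \<open>If the first arcs of all paths but the last one fail, only the flow on the last path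
  \<open>?P\<close> survives, and its capacity is 1.\<close>

lemma pm_objective_parallel_paths_le:
  assumes "pm_feasible (parallel_paths (Suc \<Gamma>)) (Suc \<Gamma>) (Suc (Suc \<Gamma>)) (\<lambda>_. 1) x"
  shows "pm_objective (parallel_paths (Suc \<Gamma>)) (Suc \<Gamma>) (Suc (Suc \<Gamma>)) \<Gamma> x \<le> 1"
proof -
  let ?G = "parallel_paths (Suc \<Gamma>)"
  let ?\<P> = "st_paths ?G (Suc \<Gamma>) (Suc (Suc \<Gamma>))"
  let ?P = "{\<Gamma>, Suc \<Gamma> + \<Gamma>}"
  have fin: "finite ?\<P>" and P: "?P \<in> ?\<P>"
    by (auto simp: st_paths_parallel_paths)
  \<comment> \<open>The arc \<open>Suc \<Gamma> + i\<close> never lies in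
    \<open>{..<\<Gamma>}\<close>, so a path is hit exactly if \<open>i < \<Gamma>\<close>.\<close>
  have "{i, Suc \<Gamma> + i} \<inter> {..<\<Gamma>} \<noteq> {} \<longleftrightarrow> {i, Suc \<Gamma> + i} \<noteq> ?P" if "i < Suc \<Gamma>" for i
    using that by (auto simp: doubleton_eq_iff)
  then have "\<forall>P\<in>?\<P>. P \<inter> {..<\<Gamma>} \<noteq> {} \<longleftrightarrow> P \<noteq> ?P"
    unfolding st_paths_parallel_paths ball_simps lessThan_iff by blast
  then have hit: "{P \<in> ?\<P>. P \<inter> {..<\<Gamma>} \<noteq> {}} = ?\<P> - {?P}"
    by blast
  have "{..<\<Gamma>} \<in> scenarios ?G \<Gamma>"
    by (auto simp: scenarios_def)
  then have "(\<Sum>P\<in>?\<P> - {?P}. x P) \<le> (MAX S\<in>scenarios ?G \<Gamma>. \<Sum>P\<in>{P \<in> ?\<P>. P \<inter> S \<noteq> {}}. x P)"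
    unfolding hit[symmetric] by (intro Max_ge finite_imageI finite_scenarios imageI) simp_all
  moreover have "(\<Sum>P\<in>?\<P>. x P) = x ?P + (\<Sum>P\<in>?\<P> - {?P}. x P)"
    using fin P by (rule sum.remove)
  moreover have "(\<Sum>P\<in>{P \<in> ?\<P>. \<Gamma> \<in> P}. x P) \<le> 1"
    using assms by (simp add: pm_feasible_def)
  then have "x ?P \<le> 1"
    by (simp add: st_paths_through_parallel_paths)
  ultimately show ?thesis
    by (simp add: pm_objective_def)
qed

text \<open>Of the total flow \<open>\<Gamma> + 1\<close>, each failing arc destroys just one unit.
  Only the values on full paths are fixed, so that the bound also serves for the flow used in the
  general model.\<close>

lemma pm_objective_parallel_paths_ge:
  assumes "\<And>P. P \<in> st_paths (parallel_paths (Suc \<Gamma>)) (Suc \<Gamma>) (Suc (Suc \<Gamma>)) \<Longrightarrow> x P = 1"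
  shows "1 \<le> pm_objective (parallel_paths (Suc \<Gamma>)) (Suc \<Gamma>) (Suc (Suc \<Gamma>)) \<Gamma> x"
proof -
  let ?G = "parallel_paths (Suc \<Gamma>)"
  let ?\<P> = "st_paths ?G (Suc \<Gamma>) (Suc (Suc \<Gamma>))"
  have "inj_on (\<lambda>i. {i, Suc \<Gamma> + i}) {..<Suc \<Gamma>}"
    by (auto simp: inj_on_def doubleton_eq_iff)
  then have "card ?\<P> = Suc \<Gamma>"
    unfolding st_paths_parallel_paths by (simp add: card_image)
  then have total: "(\<Sum>P\<in>?\<P>. x P) = Suc \<Gamma>"
    using assms by simp
  have "(\<Sum>P\<in>{P \<in> ?\<P>. P \<inter> S \<noteq> {}}. x P) \<le> \<Gamma>" if S: "S \<in> scenarios ?G \<Gamma>" for S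
  proof -
    \<comment> \<open>Sends an arc to the unique path through it; the paths hit by \<open>S\<close>
      lie in the image of \<open>S\<close>, hence there are at most \<open>card S\<close> of
      them.\<close>
    let ?path = "\<lambda>a. {a mod Suc \<Gamma>, Suc \<Gamma> + a mod Suc \<Gamma>}"
    have finS: "finite S" and cardS: "card S \<le> \<Gamma>"
      using S by (auto simp: scenarios_def intro: finite_subset)
    have "{P \<in> ?\<P>. P \<inter> S \<noteq> {}} = (\<Union>a\<in>S. {P \<in> ?\<P>. a \<in> P})"
      by blast
    also have "\<dots> = (\<Union>a\<in>S. {?path a})"
      using S by (intro SUP_cong refl st_paths_through_parallel_paths) (auto simp: scenarios_def)
    finally have "{P \<in> ?\<P>. P \<inter> S \<noteq> {}} \<subseteq> ?path ` S"
      by auto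
    with finS have "card {P \<in> ?\<P>. P \<inter> S \<noteq> {}} \<le> card S"
      by (rule surj_card_le)
    with cardS show ?thesis
      using assms by simp
  qed
  then have "(MAX S\<in>scenarios ?G \<Gamma>. \<Sum>P\<in>{P \<in> ?\<P>. P \<inter> S \<noteq> {}}. x P) \<le> \<Gamma>"
    using empty_in_scenarios by (subst Max_le_iff) (auto simp: finite_scenarios)
  with total show ?thesis
    by (simp add: pm_objective_def)
qed

lemma pm_value_parallel_paths:
  "pm_value (parallel_paths (Suc \<Gamma>)) (Suc \<Gamma>) (Suc (Suc \<Gamma>)) (\<lambda>_. 1) \<Gamma> 1"
  unfolding pm_value_def
proof (rule optimal_valueI)
  show feasible: "pm_feasible (parallel_paths (Suc \<Gamma>)) (Suc \<Gamma>) (Suc (Suc \<Gamma>)) (\<lambda>_. 1) (\<lambda>_. 1)"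
    by (simp add: pm_feasible_def st_paths_through_parallel_paths)
  show "pm_objective (parallel_paths (Suc \<Gamma>)) (Suc \<Gamma>) (Suc (Suc \<Gamma>)) \<Gamma> (\<lambda>_. 1) = 1"
    using pm_objective_parallel_paths_le[OF feasible] pm_objective_parallel_paths_ge by (simp add: antisym)
qed (rule pm_objective_parallel_paths_le)

section \<open>Optimal value of the arc model\<close>

text \<open>Node \<open>i\<close> is fed by arc \<open>i\<close> alone. As
  \<open>1 \<le> \<Gamma>\<close>, this arc may fail, and the balance at \<open>i\<close> then
  forces the flow on \<open>n + i\<close> to be at most 0.\<close>

lemma am_feasible_parallel_paths_imp_zero:
  assumes "1 \<le> \<Gamma>" and feasible: "am_feasible (parallel_paths n) n (Suc n) u \<Gamma> x"
    and "a \<in> in_arcs (parallel_paths n) (Suc n)"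
  shows "x a = 0"
proof -
  define i where "i = a - n"
  have i: "i < n" and a: "a = n + i"
    using assms(3) by (auto simp: in_arcs_sink_parallel_paths i_def)
  \<comment> \<open>The indicator of arc \<open>i\<close>, restricted to the arcs because scenario
    vectors are extensional.\<close>
  define z :: "nat \<Rightarrow> real" where "z = (\<lambda>b\<in>{..<2 * n}. if b = i then 1 else 0)"
  have "z \<in> scenario_vectors (parallel_paths n) \<Gamma>"
    using assms(1) i by (auto simp: scenario_vectors_def z_def)
  moreover have "z i = 1"
    using i by (simp add: z_def)
  ultimately have "x a \<le> 0"
    using feasible i unfolding am_feasible_def a
    by (auto simp: in_arcs_inner_parallel_paths out_arcs_inner_parallel_paths
        dest!: bspec[of _ _ i] bspec[of _ _ z])
  moreover have "0 \<le> x a"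
    using feasible i by (auto simp: am_feasible_def a)
  ultimately show ?thesis by simp
qed

lemma zero_in_scenario_vectors: "(\<lambda>a\<in>arcs G. 0) \<in> scenario_vectors G \<Gamma>"
  by (auto simp: scenario_vectors_def)

lemma am_value_parallel_paths:
  assumes "1 \<le> \<Gamma>"
  shows "am_value (parallel_paths n) n (Suc n) u \<Gamma> 0"
proof -
  have objective: "am_objective (parallel_paths n) (Suc n) \<Gamma> x = 0"
    if "\<And>a. a \<in> in_arcs (parallel_paths n) (Suc n) \<Longrightarrow> x a = 0" for x
  proof -
    \<comment> \<open>Nonemptiness makes the image of the constant 0 equal to \<open>{0}\<close>, so
      that \<open>Max\<close> is 0.\<close>
    have "scenario_vectors (parallel_paths n) \<Gamma> \<noteq> {}"
      using zero_in_scenario_vectors by blast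
    with that show ?thesis
      by (simp add: am_objective_def image_constant_conv)
  qed
  show ?thesis
    unfolding am_value_def
  proof (rule optimal_valueI)
    show "am_feasible (parallel_paths n) n (Suc n) u \<Gamma> (\<lambda>_. 0)"
      by (simp add: am_feasible_def)
    show "am_objective (parallel_paths n) (Suc n) \<Gamma> (\<lambda>_. 0) = 0"
      by (rule objective) simp
  next
    fix x assume "am_feasible (parallel_paths n) n (Suc n) u \<Gamma> x"
    then show "am_objective (parallel_paths n) (Suc n) \<Gamma> x \<le> 0"
      using am_feasible_parallel_paths_imp_zero[OF assms] objective by fastforce
  qed
qed

section \<open>Optimal value of the general model\<close>

lemma gm_objective_parallel_paths:
  assumes "\<And>i. i < n \<Longrightarrow> x {n + i} = 0"
  shows "gm_objective (parallel_paths n) n (Suc n) \<Gamma> x =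
    pm_objective (parallel_paths n) n (Suc n) \<Gamma> x"
proof -
  let ?\<P> = "st_paths (parallel_paths n) n (Suc n)"
  let ?\<Q> = "in_subpaths (parallel_paths n) n (Suc n) (Suc n)"
  have "(\<Sum>P\<in>{P \<in> ?\<Q>. Q P}. x P) = (\<Sum>P\<in>{P \<in> ?\<P>. Q P}. x P)" for Q
    using assms
    by (intro sum.mono_neutral_right)
      (auto simp: in_subpaths_sink_parallel_paths st_paths_parallel_paths)
  \<comment> \<open>The trivial predicate yields the total flow, the general one the loss in each
    scenario.\<close>
  from this[of "\<lambda>_. True"] this show ?thesis
    by (simp add: gm_objective_def pm_objective_def)
qed

text \<open>As in the arc model: the only subpath ending at node \<open>i\<close> is
  \<open>{i}\<close>, and the scenario \<open>{i}\<close> destroys it.\<close>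

lemma gm_feasible_parallel_paths_imp_zero:
  assumes "1 \<le> \<Gamma>" and feasible: "gm_feasible (parallel_paths n) n (Suc n) u \<Gamma> x" and i: "i < n"
  shows "x {n + i} = 0"
proof -
  let ?G = "parallel_paths n"
  have "\<forall>v\<in>verts ?G - {n, Suc n}. \<forall>S\<in>scenarios ?G \<Gamma>.
      (\<Sum>P\<in>out_subpaths ?G n (Suc n) v. x P) \<le> (\<Sum>P\<in>in_subpaths ?G n (Suc n) v. x P) -
        (\<Sum>P\<in>{P \<in> in_subpaths ?G n (Suc n) v. P \<inter> S \<noteq> {}}. x P)"
    using feasible unfolding gm_feasible_def by (elim conjE)
  moreover have "{i} \<in> scenarios ?G \<Gamma>" and "i \<in> verts ?G - {n, Suc n}"
    using assms(1) i by (simp_all add: scenarios_def)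
  ultimately have "(\<Sum>P\<in>out_subpaths ?G n (Suc n) i. x P) \<le>
      (\<Sum>P\<in>in_subpaths ?G n (Suc n) i. x P) -
        (\<Sum>P\<in>{P \<in> in_subpaths ?G n (Suc n) i. P \<inter> {i} \<noteq> {}}. x P)"
    by blast
  moreover have "{P \<in> {{i}}. P \<inter> {i} \<noteq> {}} = {{i}}"
    by auto
  ultimately have "x {n + i} \<le> 0"
    using i by (simp only: in_subpaths_inner_parallel_paths out_subpaths_inner_parallel_paths) simp
  moreover have "0 \<le> x {n + i}"
    using feasible i by (auto simp: gm_feasible_def subpaths_parallel_paths)
  ultimately show ?thesis by simp
qed

text \<open>Full paths are among the subpaths, so passing to them only drops nonnegative terms from
  the capacity sums.\<close>

lemma gm_feasible_parallel_paths_imp_pm_feasible: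
  assumes "gm_feasible (parallel_paths n) n (Suc n) u \<Gamma> x"
  shows "pm_feasible (parallel_paths n) n (Suc n) u x"
proof -
  have subset: "st_paths (parallel_paths n) n (Suc n) \<subseteq> subpaths (parallel_paths n) n (Suc n)"
    and fin: "finite (subpaths (parallel_paths n) n (Suc n))"
    by (auto simp: subpaths_parallel_paths st_paths_parallel_paths)
  have "(\<Sum>P\<in>{P \<in> st_paths (parallel_paths n) n (Suc n). a \<in> P}. x P) \<le>
      (\<Sum>P\<in>{P \<in> subpaths (parallel_paths n) n (Suc n). a \<in> P}. x P)" for a
    using assms subset fin by (intro sum_mono2) (auto simp: gm_feasible_def)
  with assms subset show ?thesis
    unfolding pm_feasible_def gm_feasible_def by (meson order_trans subsetD)
qed

text \<open>Only single arcs start or end at inner nodes. The indicator of the full paths vanishes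
  on them, so every balance condition reads 0 \<ge> 0.\<close>

lemma gm_feasible_parallel_paths_st_paths:
  "gm_feasible (parallel_paths n) n (Suc n) (\<lambda>_. 1) \<Gamma>
     (\<lambda>P. of_bool (P \<in> st_paths (parallel_paths n) n (Suc n)))"
proof -
  let ?G = "parallel_paths n"
  let ?\<P> = "st_paths ?G n (Suc n)"
  let ?x = "\<lambda>P. of_bool (P \<in> ?\<P>) :: real"
  have arc: "{a} \<notin> ?\<P>" for a
    by (auto simp: st_paths_parallel_paths)
  have "(\<Sum>P\<in>{P \<in> subpaths ?G n (Suc n). a \<in> P}. ?x P) \<le> 1" if "a < 2 * n" for a
  proof -
    have "(\<Sum>P\<in>{P \<in> subpaths ?G n (Suc n). a \<in> P}. ?x P) = (\<Sum>P\<in>{P \<in> ?\<P>. a \<in> P}. ?x P)"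
      by (intro sum.mono_neutral_right)
        (auto simp: subpaths_parallel_paths st_paths_parallel_paths)
    also have "\<dots> = (\<Sum>P\<in>{P \<in> ?\<P>. a \<in> P}. 1)"
      by (intro sum.cong) auto
    finally show ?thesis
      using that by (simp add: st_paths_through_parallel_paths)
  qed
  moreover have "(\<Sum>P\<in>{P \<in> {{i}}. Q P}. ?x P) = 0" for i Q
    using arc by (intro sum.neutral) auto
  ultimately show ?thesis
    using arc by (auto simp: gm_feasible_def in_subpaths_inner_parallel_paths
        out_subpaths_inner_parallel_paths)
qed

text \<open>Feasible flows vanish on the last arcs taken alone, so both bounds are inherited from
  the path model.\<close>

lemma gm_value_parallel_paths:
  assumes "1 \<le> \<Gamma>"
  shows "gm_value (parallel_paths (Suc \<Gamma>)) (Suc \<Gamma>) (Suc (Suc \<Gamma>)) (\<lambda>_. 1) \<Gamma> 1"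
proof -
  let ?G = "parallel_paths (Suc \<Gamma>)" and ?s = "Suc \<Gamma>" and ?t = "Suc (Suc \<Gamma>)"
  let ?x = "\<lambda>P. of_bool (P \<in> st_paths ?G ?s ?t) :: real"
  have le: "gm_objective ?G ?s ?t \<Gamma> y \<le> 1" if "gm_feasible ?G ?s ?t (\<lambda>_. 1) \<Gamma> y" for y
  proof -
    have "gm_objective ?G ?s ?t \<Gamma> y = pm_objective ?G ?s ?t \<Gamma> y"
      using gm_feasible_parallel_paths_imp_zero[OF assms that]
      by (intro gm_objective_parallel_paths)
    also have "\<dots> \<le> 1"
      using gm_feasible_parallel_paths_imp_pm_feasible[OF that]
      by (rule pm_objective_parallel_paths_le)
    finally show ?thesis .
  qed
  have "gm_objective ?G ?s ?t \<Gamma> ?x = pm_objective ?G ?s ?t \<Gamma> ?x"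
    using gm_feasible_parallel_paths_imp_zero[OF assms gm_feasible_parallel_paths_st_paths]
    by (intro gm_objective_parallel_paths)
  also have "1 \<le> \<dots>"
    by (intro pm_objective_parallel_paths_ge) simp
  finally have "gm_objective ?G ?s ?t \<Gamma> ?x = 1"
    using le[OF gm_feasible_parallel_paths_st_paths] by (rule order.antisym[rotated])
  with le gm_feasible_parallel_paths_st_paths show ?thesis
    unfolding gm_value_def by (intro optimal_valueI)
qed

text \<open>The arc model has value 0 and the other two have value 1, so both inequalities become 1
  > \<alpha> * 0 and one network serves every \<alpha>.\<close>

theorem proposition3p8:
  fixes \<Gamma> :: nat and \<alpha> :: real
  assumes "1 \<le> \<Gamma>"
  shows "\<exists>(G :: (nat, nat) pre_digraph) s t u f_pm f_am f_gm.
    flow_network G s t u \<and>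
    pm_value G s t u \<Gamma> f_pm \<and> am_value G s t u \<Gamma> f_am \<and> gm_value G s t u \<Gamma> f_gm \<and>
    f_pm > \<alpha> * f_am \<and> f_gm > \<alpha> * f_am"
proof (intro exI conjI)
  show "flow_network (parallel_paths (Suc \<Gamma>)) (Suc \<Gamma>) (Suc (Suc \<Gamma>)) (\<lambda>_. 1)"
    by (rule flow_network_parallel_paths)
  show "pm_value (parallel_paths (Suc \<Gamma>)) (Suc \<Gamma>) (Suc (Suc \<Gamma>)) (\<lambda>_. 1) \<Gamma> 1"
    by (rule pm_value_parallel_paths)
  show "am_value (parallel_paths (Suc \<Gamma>)) (Suc \<Gamma>) (Suc (Suc \<Gamma>)) (\<lambda>_. 1) \<Gamma> 0"
    using assms by (rule am_value_parallel_paths)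
  show "gm_value (parallel_paths (Suc \<Gamma>)) (Suc \<Gamma>) (Suc (Suc \<Gamma>)) (\<lambda>_. 1) \<Gamma> 1"
    using assms by (rule gm_value_parallel_paths)
qed simp_all

end
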